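(* Let $(F_x)_{x\in\mathbb{R}^d}$ be a germ with the following property: there exist a distribution $f\in\mathcal{D}'$, numbers $\gamma\in\mathbb{R}$, $r\in\mathbb{N}$, $C<\infty$ and a set $K\subseteq\mathbb{R}^d$ such that $$|(f-F_x)(\psi_x^\lambda)|\le C\,\lambda^\gamma\qquad\text{for all }x\in K,\ \lambda\in(0,1]\text{ and }\psi\in\mathcal{B}_r.$$ Then for $\alpha:=\min\{-r-d,\gamma\}$ we have $$|(F_z-F_y)(\psi_y^\lambda)|\le 2C\,\lambda^\alpha\,(|z-y|+\lambda)^{\gamma-\alpha}$$ for all $y,z\in K$ with $|z-y|\le\frac12$, all $\lambda\in(0,\frac12]$ and all $\psi\in\mathcal{B}_r$.
   Context: $\mathbb{N}=\{1,2,\dots\}$. $\mathcal{D}$ is the space of $C^\infty$ compactly supported functions $\mathbb{R}^d\to\mathbb{R}$, $\mathcal{D}(K)$ those supported in $K$, $\mathcal{D}'$ the space of distributions on $\mathbb{R}^d$. A germ is a family $F=(F_x)_{x\in\mathbb{R}^d}$ of distributions $F_x\in\mathcal{D}'$ such that $x\mapsto F_x(\psi)$ is measurable for all $\psi\in\mathcal{D}$. $B(x,R)$ is the closed Euclidean ball; $\|\varphi\|_{C^r}:=\max_{|k|\le r}\|\partial^k\varphi\|_\infty$; $\mathcal{B}_r:=\{\psi\in\mathcal{D}(B(0,1)):\|\psi\|_{C^r}\le 1\}$; $\varphi_x^\lambda(z):=\lambda^{-d}\varphi(\lambda^{-1}(z-x))$. *)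

theory Defs
  imports "HOL-Analysis.Analysis"
begin

text \<open>The space R^d is \<open>real ^ 'n\<close> with \<open>d = CARD('n)\<close>.\<close>

definition partial_deriv :: "'n \<Rightarrow> (real ^ 'n \<Rightarrow> real) \<Rightarrow> (real ^ 'n \<Rightarrow> real)" where
  "partial_deriv i \<phi> x = deriv (\<lambda>t. \<phi> (x + t *\<^sub>R axis i 1)) 0"

definition iter_partial :: "'n list \<Rightarrow> (real ^ 'n \<Rightarrow> real) \<Rightarrow> (real ^ 'n \<Rightarrow> real)" where
  "iter_partial js \<phi> = foldr partial_deriv js \<phi>"

text \<open>\<open>C\<close>-infinity: all iterated partial derivatives, in any order, exist and are continuous.
  Existence has to be demanded explicitly, since \<open>deriv\<close> is total.\<close>

definition smooth :: "(real ^ 'n \<Rightarrow> real) \<Rightarrow> bool" where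
  "smooth \<phi> \<longleftrightarrow>
     (\<forall>js. continuous_on UNIV (iter_partial js \<phi>) \<and>
       (\<forall>i x. (\<lambda>t. iter_partial js \<phi> (x + t *\<^sub>R axis i 1)) field_differentiable at 0))"

text \<open>The index type carries no order, so an arbitrary enumeration of the coordinates is fixed
  in order to write the derivative for a multi-index \<open>k\<close> as
  (d/dx_1)^(k_1) ... (d/dx_d)^(k_d).  For smooth functions the enumeration is irrelevant.\<close>

definition coords :: "'n::finite list" where
  "coords = (SOME js. set js = UNIV \<and> distinct js)"

lemma coords: "set (coords :: 'n::finite list) = UNIV" "distinct (coords :: 'n list)"
proof -
  have "\<exists>js :: 'n list. set js = UNIV \<and> distinct js"
    using finite_distinct_list[OF finite_class.finite_UNIV] by blast
  from someI_ex[OF this] show "set (coords :: 'n list) = UNIV" "distinct (coords :: 'n list)"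
    by (auto simp: coords_def)
qed

definition multi_deriv :: "('n::finite \<Rightarrow> nat) \<Rightarrow> (real ^ 'n \<Rightarrow> real) \<Rightarrow> (real ^ 'n \<Rightarrow> real)" where
  "multi_deriv k \<phi> = iter_partial (concat (map (\<lambda>i. replicate (k i) i) coords)) \<phi>"

definition sup_norm :: "(real ^ 'n \<Rightarrow> real) \<Rightarrow> real" where
  "sup_norm \<phi> = (SUP x. \<bar>\<phi> x\<bar>)"

text \<open>Only meaningful for functions whose derivatives up to order \<open>r\<close> are bounded; it is only
  applied to test functions.\<close>

definition Cr_norm :: "nat \<Rightarrow> (real ^ 'n::finite \<Rightarrow> real) \<Rightarrow> real" where
  "Cr_norm r \<phi> = Max ((\<lambda>k. sup_norm (multi_deriv k \<phi>)) ` {k. (\<Sum>i\<in>UNIV. k i) \<le> r})"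

definition supp :: "(real ^ 'n \<Rightarrow> real) \<Rightarrow> (real ^ 'n) set" where
  "supp \<phi> = closure {x. \<phi> x \<noteq> 0}"

definition test_funs :: "(real ^ 'n \<Rightarrow> real) set" where
  "test_funs = {\<phi>. smooth \<phi> \<and> compact (supp \<phi>)}"

definition test_funs_in :: "(real ^ 'n) set \<Rightarrow> (real ^ 'n \<Rightarrow> real) set" where
  "test_funs_in K = {\<phi> \<in> test_funs. supp \<phi> \<subseteq> K}"

text \<open>A distribution is represented by a functional on all functions; its values outside
  \<open>test_funs\<close> are irrelevant.  Continuity is the usual local seminorm estimate.\<close>

definition distribution :: "((real ^ 'n::finite \<Rightarrow> real) \<Rightarrow> real) \<Rightarrow> bool" where
  "distribution T \<longleftrightarrow>
     (\<forall>\<phi>\<in>test_funs. \<forall>\<psi>\<in>test_funs. T (\<lambda>x. \<phi> x + \<psi> x) = T \<phi> + T \<psi>) \<and>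
     (\<forall>\<phi>\<in>test_funs. \<forall>c. T (\<lambda>x. c * \<phi> x) = c * T \<phi>) \<and>
     (\<forall>K. compact K \<longrightarrow>
        (\<exists>C m. \<forall>\<phi>\<in>test_funs_in K. \<bar>T \<phi>\<bar> \<le> C * Cr_norm m \<phi>))"

definition germ :: "(real ^ 'n::finite \<Rightarrow> (real ^ 'n \<Rightarrow> real) \<Rightarrow> real) \<Rightarrow> bool" where
  "germ F \<longleftrightarrow>
     (\<forall>x. distribution (F x)) \<and>
     (\<forall>\<psi>\<in>test_funs. (\<lambda>x. F x \<psi>) \<in> borel_measurable borel)"

definition unit_tests :: "nat \<Rightarrow> (real ^ 'n::finite \<Rightarrow> real) set" where
  "unit_tests r = {\<psi> \<in> test_funs_in (cball 0 1). Cr_norm r \<psi> \<le> 1}"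

definition rescale ::
    "(real ^ 'n::finite \<Rightarrow> real) \<Rightarrow> real ^ 'n \<Rightarrow> real \<Rightarrow> (real ^ 'n \<Rightarrow> real)" where
  "rescale \<phi> x l = (\<lambda>z. inverse l ^ CARD('n) * \<phi> (inverse l *\<^sub>R (z - x)))"

end

theory Submission
  imports Defs
begin

text \<open>Fix \<open>y, z \<in> K\<close> and put \<open>m = |z - y| + l\<close>. The ball \<open>B(y, l)\<close> lies in \<open>B(z, m)\<close>, so a test
  function at scale \<open>l\<close> around \<open>y\<close> may also be read as a test function at scale \<open>m\<close> around \<open>z\<close>:
  one has \<open>\<psi>\<^sub>y\<^sup>l = \<xi>\<^sub>z\<^sup>m\<close>, where \<open>\<xi>\<close> is \<open>\<psi>\<close> rescaled by \<open>h = l / m\<close> around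
  \<open>w = (y - z) / m\<close>. Since \<open>|w| + h = 1\<close>, the support of \<open>\<xi>\<close> stays in the unit ball
  (\<open>supp_rescale\<close>), and the price of the rescaling is a factor \<open>h\<^bsup>-r-d\<^esup>\<close> in the \<open>C\<^sup>r\<close> norm:
  \<open>h\<^bsup>-d\<^esup>\<close> from the normalisation and at most \<open>h\<^sup>-\<^sup>r\<close> from the derivatives
  (\<open>scaled_rescale_in_unit_tests\<close>). The bound on \<open>f - F z\<close> around \<open>z\<close> at scale \<open>m\<close> therefore
  gives \<open>|(f - F z) (\<psi>\<^sub>y\<^sup>l)| \<le> C h\<^bsup>-r-d\<^esup> m\<^sup>\<gamma> \<le> C h\<^sup>\<alpha> m\<^sup>\<gamma> = C l\<^sup>\<alpha> m\<^bsup>\<gamma>-\<alpha>\<^esup>\<close>, because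
  \<open>h \<le> 1\<close> and \<open>\<alpha> \<le> -r-d\<close>. The bound on \<open>f - F y\<close> around \<open>y\<close> at scale \<open>l\<close> gives
  \<open>C l\<^sup>\<gamma> = C l\<^sup>\<alpha> l\<^bsup>\<gamma>-\<alpha>\<^esup> \<le> C l\<^sup>\<alpha> m\<^bsup>\<gamma>-\<alpha>\<^esup>\<close>, because \<open>\<alpha> \<le> \<gamma>\<close> and \<open>l \<le> m\<close>.
  The triangle inequality adds the two. The conditions \<open>|z - y| \<le> 1/2\<close> and \<open>l \<le> 1/2\<close> ensure
  \<open>m \<le> 1\<close>.\<close>

section \<open>Iterated partial derivatives under affine changes of variable\<close>

lemma iter_partial_simps:
  "iter_partial [] \<phi> = \<phi>" "iter_partial (j # js) \<phi> = partial_deriv j (iter_partial js \<phi>)"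
  by (simp_all add: iter_partial_def)

text \<open>The chain rule in one coordinate direction, stated with existence of the derivative because
  \<open>smooth\<close> demands existence separately from the value of \<open>partial_deriv\<close>.\<close>

lemma has_derivative_along_axis_affine:
  fixes g :: "real ^ 'n \<Rightarrow> real"
  assumes "(\<lambda>t. g (a *\<^sub>R (x - w) + t *\<^sub>R axis i 1)) field_differentiable at 0"
  shows "((\<lambda>t. c * g (a *\<^sub>R (x + t *\<^sub>R axis i 1 - w))) has_field_derivative
           c * a * partial_deriv i g (a *\<^sub>R (x - w))) (at 0)"
proof -
  let ?G = "\<lambda>t. g (a *\<^sub>R (x - w) + t *\<^sub>R axis i 1)"
  have "(?G has_field_derivative partial_deriv i g (a *\<^sub>R (x - w))) (at (a * 0))"
    using assms by (simp add: field_differentiable_derivI partial_deriv_def)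
  moreover have "((*) a has_field_derivative a) (at 0)"
    by (auto intro!: derivative_eq_intros)
  ultimately have "((\<lambda>t. c * ?G (a * t)) has_field_derivative
      c * (partial_deriv i g (a *\<^sub>R (x - w)) * a)) (at 0)"
    by (intro DERIV_cmult DERIV_chain2)
  moreover have "(\<lambda>t. c * ?G (a * t)) = (\<lambda>t. c * g (a *\<^sub>R (x + t *\<^sub>R axis i 1 - w)))"
    by (simp add: algebra_simps)
  ultimately show ?thesis by (simp add: mult_ac)
qed

lemma iter_partial_affine:
  fixes \<phi> :: "real ^ 'n \<Rightarrow> real"
  assumes "smooth \<phi>"
  shows "iter_partial js (\<lambda>z. c * \<phi> (a *\<^sub>R (z - w))) =
           (\<lambda>z. c * a ^ length js * iter_partial js \<phi> (a *\<^sub>R (z - w)))"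
proof (induction js)
  case Nil
  show ?case by (simp add: iter_partial_simps)
next
  case (Cons j js)
  show ?case
  proof
    fix x
    have "(\<lambda>t. iter_partial js \<phi> (a *\<^sub>R (x - w) + t *\<^sub>R axis j 1)) field_differentiable at 0"
      using assms by (simp add: smooth_def)
    from has_derivative_along_axis_affine[OF this, of "c * a ^ length js", THEN DERIV_imp_deriv]
    show "iter_partial (j # js) (\<lambda>z. c * \<phi> (a *\<^sub>R (z - w))) x =
        c * a ^ length (j # js) * iter_partial (j # js) \<phi> (a *\<^sub>R (x - w))"
      by (simp add: iter_partial_simps Cons.IH partial_deriv_def[of j "\<lambda>z. _ z"] mult_ac)
  qed
qed

lemma smooth_affine:
  fixes \<phi> :: "real ^ 'n \<Rightarrow> real"
  assumes "smooth \<phi>"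
  shows "smooth (\<lambda>z. c * \<phi> (a *\<^sub>R (z - w)))"
  unfolding smooth_def iter_partial_affine[OF assms]
proof (intro allI conjI)
  fix js :: "'n list"
  have "continuous_on UNIV (iter_partial js \<phi>)"
    using assms by (simp add: smooth_def)
  moreover have "continuous_on UNIV (\<lambda>z. a *\<^sub>R (z - w))"
    by (intro continuous_intros)
  ultimately have "continuous_on UNIV (\<lambda>z. iter_partial js \<phi> (a *\<^sub>R (z - w)))"
    by (rule continuous_on_compose2) simp
  then show "continuous_on UNIV
      (\<lambda>z. c * a ^ length js * iter_partial js \<phi> (a *\<^sub>R (z - w)))"
    by (rule continuous_on_mult_left)
next
  fix js :: "'n list" and i x
  have "(\<lambda>t. iter_partial js \<phi> (a *\<^sub>R (x - w) + t *\<^sub>R axis i 1)) field_differentiable at 0"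
    using assms by (simp add: smooth_def)
  from has_derivative_along_axis_affine[OF this, of "c * a ^ length js"]
  show "(\<lambda>t. c * a ^ length js * iter_partial js \<phi> (a *\<^sub>R (x + t *\<^sub>R axis i 1 - w)))
      field_differentiable at 0"
    unfolding field_differentiable_def by (rule exI)
qed

section \<open>Bounds in the \<open>C\<^sup>r\<close> norm\<close>

text \<open>The complement of the support is open, so around each of its points the function vanishes
  on a segment in every coordinate direction; hence so do its partial derivatives.\<close>

lemma iter_partial_eq_0_outside_supp:
  fixes \<phi> :: "real ^ 'n \<Rightarrow> real"
  assumes "x \<notin> supp \<phi>"
  shows "iter_partial js \<phi> x = 0"
  using assms
proof (induction js arbitrary: x)
  case Nil
  then show ?case
    using closure_subset[of "{x. \<phi> x \<noteq> 0}"] by (auto simp: iter_partial_simps supp_def)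
next
  case (Cons j js)
  let ?line = "\<lambda>t. x + t *\<^sub>R axis j (1::real)"
  have "open (- supp \<phi>)" by (simp add: supp_def open_Compl)
  then have "open (?line -` (- supp \<phi>))"
    by (rule open_vimage) (intro continuous_intros)
  moreover have "0 \<in> ?line -` (- supp \<phi>)" using Cons.prems by simp
  ultimately have "eventually (\<lambda>t. t \<in> ?line -` (- supp \<phi>)) (nhds 0)"
    by (rule eventually_nhds_in_open)
  then have "eventually (\<lambda>t. iter_partial js \<phi> (?line t) = 0) (nhds 0)"
    by eventually_elim (simp add: Cons.IH)
  then have "deriv (\<lambda>t. iter_partial js \<phi> (?line t)) 0 = deriv (\<lambda>t. 0) (0::real)"
    by (rule deriv_cong_ev) simp
  then show ?case by (simp add: iter_partial_simps partial_deriv_def)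
qed

text \<open>Boundedness of the derivatives makes \<open>sup_norm\<close> a genuine supremum.\<close>

lemma abs_iter_partial_le_sup_norm:
  fixes \<phi> :: "real ^ 'n \<Rightarrow> real"
  assumes "\<phi> \<in> test_funs"
  shows "\<bar>iter_partial js \<phi> x\<bar> \<le> sup_norm (iter_partial js \<phi>)"
proof -
  have "continuous_on (supp \<phi>) (iter_partial js \<phi>)" "compact (supp \<phi>)"
    using assms continuous_on_subset by (auto simp: test_funs_def smooth_def)
  then have "bounded (iter_partial js \<phi> ` supp \<phi>)"
    by (intro compact_imp_bounded compact_continuous_image)
  then obtain B where B: "\<And>x. x \<in> supp \<phi> \<Longrightarrow> \<bar>iter_partial js \<phi> x\<bar> \<le> B"
    by (auto simp: bounded_iff)
  have "\<bar>iter_partial js \<phi> x\<bar> \<le> max B 0" for x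
    using B[of x] iter_partial_eq_0_outside_supp[of x \<phi> js] by (cases "x \<in> supp \<phi>") auto
  then have "bdd_above (range (\<lambda>x. \<bar>iter_partial js \<phi> x\<bar>))"
    by (auto simp: bdd_above_def)
  then show ?thesis
    unfolding sup_norm_def by (rule cSUP_upper[OF UNIV_I])
qed

lemma finite_multi_indices: "finite {k :: 'n::finite \<Rightarrow> nat. (\<Sum>i\<in>UNIV. k i) \<le> r}"
proof (rule finite_subset)
  show "{k :: 'n \<Rightarrow> nat. (\<Sum>i\<in>UNIV. k i) \<le> r} \<subseteq> (UNIV :: 'n set) \<rightarrow>\<^sub>E {..r}"
  proof
    fix k :: "'n \<Rightarrow> nat"
    assume "k \<in> {k. (\<Sum>i\<in>UNIV. k i) \<le> r}"
    moreover have "k i \<le> (\<Sum>i\<in>UNIV. k i)" for i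
      by (rule member_le_sum) auto
    ultimately have "k i \<le> r" for i
      using order_trans by blast
    then show "k \<in> UNIV \<rightarrow>\<^sub>E {..r}" by (simp add: PiE_iff)
  qed
qed (simp add: finite_PiE)

lemma length_multi_index:
  "length (concat (map (\<lambda>i. replicate (k i) i) (coords :: 'n::finite list))) = (\<Sum>i\<in>UNIV. k i)"
  using coords[where 'n = 'n]
  by (simp add: length_concat comp_def sum_list_distinct_conv_sum_set)

lemma Cr_norm_le_iff:
  "Cr_norm r \<phi> \<le> M \<longleftrightarrow> (\<forall>k. (\<Sum>i\<in>UNIV. k i) \<le> r \<longrightarrow> sup_norm (multi_deriv k \<phi>) \<le> M)"
proof -
  have "{k :: 'a \<Rightarrow> nat. (\<Sum>i\<in>UNIV. k i) \<le> r} \<noteq> {}"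
    by (auto intro!: exI[of _ "\<lambda>_. 0"])
  then show ?thesis
    unfolding Cr_norm_def by (subst Max_le_iff) (auto simp: finite_multi_indices)
qed

text \<open>A derivative of order \<open>k\<close> picks up the factor \<open>a\<^sup>k\<close>; as \<open>a \<ge> 1\<close>, the top order \<open>r\<close> costs
  most.\<close>

lemma Cr_norm_affine_le:
  fixes \<phi> :: "real ^ 'n::finite \<Rightarrow> real"
  assumes "\<phi> \<in> test_funs" and "a \<ge> 1" and "c \<ge> 0"
  shows "Cr_norm r (\<lambda>z. c * \<phi> (a *\<^sub>R (z - w))) \<le> c * a ^ r * Cr_norm r \<phi>"
  unfolding Cr_norm_le_iff
proof (intro allI impI)
  fix k :: "'n \<Rightarrow> nat"
  assume k: "(\<Sum>i\<in>UNIV. k i) \<le> r"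
  define js where "js = concat (map (\<lambda>i. replicate (k i) i) coords)"
  have len: "length js \<le> r" using k by (simp add: js_def length_multi_index)
  have smooth: "smooth \<phi>" using assms by (simp add: test_funs_def)
  have norm: "sup_norm (iter_partial js \<phi>) \<le> Cr_norm r \<phi>"
    using Cr_norm_le_iff[of r \<phi> "Cr_norm r \<phi>"] k by (simp add: js_def multi_deriv_def)
  show "sup_norm (multi_deriv k (\<lambda>z. c * \<phi> (a *\<^sub>R (z - w)))) \<le> c * a ^ r * Cr_norm r \<phi>"
    unfolding multi_deriv_def js_def[symmetric] iter_partial_affine[OF smooth] sup_norm_def
  proof (rule cSUP_least)
    fix x
    have "\<bar>c * a ^ length js * iter_partial js \<phi> (a *\<^sub>R (x - w))\<bar> =
        c * a ^ length js * \<bar>iter_partial js \<phi> (a *\<^sub>R (x - w))\<bar>"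
      using assms by (simp add: abs_mult)
    also have "\<dots> \<le> c * a ^ r * Cr_norm r \<phi>"
      using assms len order_trans[OF abs_iter_partial_le_sup_norm[OF assms(1)] norm]
      by (intro mult_mono power_increasing) auto
    finally show "\<bar>c * a ^ length js * iter_partial js \<phi> (a *\<^sub>R (x - w))\<bar>
        \<le> c * a ^ r * Cr_norm r \<phi>" .
  qed simp
qed

section \<open>Rescaled test functions\<close>

lemma smooth_rescale: "smooth \<phi> \<Longrightarrow> smooth (rescale \<phi> x l)"
  unfolding rescale_def by (rule smooth_affine)

lemma supp_rescale:
  fixes \<phi> :: "real ^ 'n::finite \<Rightarrow> real"
  assumes "supp \<phi> \<subseteq> cball 0 1" and "l > 0"
  shows "supp (rescale \<phi> x l) \<subseteq> cball x l"
  unfolding supp_def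
proof (rule closure_minimal)
  show "{z. rescale \<phi> x l z \<noteq> 0} \<subseteq> cball x l"
  proof
    fix z
    assume "z \<in> {z. rescale \<phi> x l z \<noteq> 0}"
    then have "inverse l *\<^sub>R (z - x) \<in> supp \<phi>"
      using closure_subset[of "{x. \<phi> x \<noteq> 0}"] by (auto simp: rescale_def supp_def)
    with assms have "norm (inverse l *\<^sub>R (z - x)) \<le> 1" by auto
    then show "z \<in> cball x l"
      using assms(2) by (simp add: dist_norm norm_minus_commute pos_divide_le_eq
          divide_inverse_commute[symmetric])
  qed
qed simp

lemma rescale_in_test_funs:
  assumes "\<phi> \<in> test_funs_in (cball 0 1)" and "l > 0"
  shows "rescale \<phi> x l \<in> test_funs"
proof -
  have "bounded (supp (rescale \<phi> x l))"
    using assms by (intro bounded_subset[OF bounded_cball supp_rescale])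
      (auto simp: test_funs_in_def)
  then show ?thesis
    using assms(1) smooth_rescale[of \<phi> x l]
    by (simp add: test_funs_in_def test_funs_def compact_eq_bounded_closed supp_def)
qed

lemma rescale_rescale:
  fixes \<phi> :: "real ^ 'n::finite \<Rightarrow> real"
  assumes "m > 0"
  shows "rescale (rescale \<phi> w h) z m = rescale \<phi> (z + m *\<^sub>R w) (h * m)"
proof
  fix u
  have "inverse m *\<^sub>R (u - z) - w = inverse m *\<^sub>R (u - (z + m *\<^sub>R w))"
    using assms by (simp add: algebra_simps)
  then show "rescale (rescale \<phi> w h) z m u = rescale \<phi> (z + m *\<^sub>R w) (h * m) u"
    by (simp add: rescale_def power_mult_distrib mult_ac)
qed

text \<open>Shrinking \<open>\<psi>\<close> into a ball of radius \<open>h\<close> inside the unit ball multiplies each derivative of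
  order at most \<open>r\<close> by at most \<open>h\<^bsup>-d-r\<^esup>\<close>, so the prefactor \<open>h\<^bsup>d+r\<^esup>\<close> restores the unit bound.\<close>

lemma scaled_rescale_in_unit_tests:
  fixes \<psi> :: "real ^ 'n::finite \<Rightarrow> real"
  assumes "\<psi> \<in> unit_tests r" and "0 < h" and "norm w + h \<le> 1"
  shows "(\<lambda>u. h ^ (CARD('n) + r) * rescale \<psi> w h u) \<in> unit_tests r"
proof -
  let ?\<xi> = "\<lambda>u. h ^ (CARD('n) + r) * rescale \<psi> w h u"
  have \<psi>: "\<psi> \<in> test_funs" "supp \<psi> \<subseteq> cball 0 1" "Cr_norm r \<psi> \<le> 1"
    using assms(1) by (auto simp: unit_tests_def test_funs_in_def)
  have "h \<le> 1" using assms(3) norm_ge_zero[of w] by linarith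
  have \<xi>: "?\<xi> = (\<lambda>u. h ^ r * \<psi> (inverse h *\<^sub>R (u - w)))"
    using assms(2) by (simp add: rescale_def power_add power_inverse fun_eq_iff)
  have smooth: "smooth ?\<xi>"
    unfolding \<xi> using \<psi>(1) by (intro smooth_affine) (simp add: test_funs_def)
  have "supp ?\<xi> = supp (rescale \<psi> w h)"
    using assms(2) by (simp add: supp_def)
  also have "\<dots> \<subseteq> cball w h"
    by (rule supp_rescale[OF \<psi>(2) assms(2)])
  also have "\<dots> \<subseteq> cball 0 1"
    using assms(3) by (subst cball_subset_cball_iff) simp
  finally have supp: "supp ?\<xi> \<subseteq> cball 0 1" .
  then have "bounded (supp ?\<xi>)" using bounded_cball bounded_subset by blast
  then have "compact (supp ?\<xi>)" by (simp add: compact_eq_bounded_closed supp_def)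
  moreover have "Cr_norm r ?\<xi> \<le> 1"
  proof -
    have "Cr_norm r ?\<xi> \<le> h ^ r * inverse h ^ r * Cr_norm r \<psi>"
      unfolding \<xi> using \<psi>(1) assms(2) \<open>h \<le> 1\<close>
      by (intro Cr_norm_affine_le) (auto simp: one_le_inverse)
    also have "\<dots> = Cr_norm r \<psi>"
      using assms(2) by (simp add: power_inverse)
    finally show ?thesis using \<psi>(3) by simp
  qed
  ultimately show ?thesis
    using smooth supp by (simp add: unit_tests_def test_funs_in_def test_funs_def)
qed

section \<open>Changing the base point and the scale\<close>

text \<open>An estimate around \<open>z\<close> at the larger scale \<open>m\<close> controls test functions at scale \<open>l\<close> around
  nearby points \<open>y\<close>, at the cost of a power of the ratio of the two scales: up to a factor,
  such a test function is itself one at scale \<open>m\<close> around \<open>z\<close>, and the functionals are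
  homogeneous.\<close>

lemma recentered_estimate:
  fixes T S :: "(real ^ 'n::finite \<Rightarrow> real) \<Rightarrow> real"
  assumes "distribution T" and "distribution S"
    and est: "\<And>\<psi>. \<psi> \<in> unit_tests r \<Longrightarrow> \<bar>T (rescale \<psi> z m) - S (rescale \<psi> z m)\<bar> \<le> M"
    and \<psi>: "\<psi> \<in> unit_tests r" and "0 < l" and "norm (y - z) + l \<le> m"
  shows "\<bar>T (rescale \<psi> y l) - S (rescale \<psi> y l)\<bar> \<le> M * (l / m) powr (- real r - real CARD('n))"
proof -
  \<comment> \<open>Radius and centre of \<open>B(y, l)\<close> in the coordinates that map \<open>B(z, m)\<close> to the unit ball.\<close>
  define h where "h = l / m"
  define w where "w = inverse m *\<^sub>R (y - z)"
  define c where "c = h ^ (CARD('n) + r)"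
  have m: "m > 0" using assms(5,6) norm_ge_zero[of "y - z"] by linarith
  have h: "h > 0" using m assms(5) by (simp add: h_def)
  have c: "c > 0" using h by (simp add: c_def)
  have "norm w + h = (norm (y - z) + l) / m"
    using m by (simp add: w_def h_def divide_inverse distrib_left mult.commute)
  also have "\<dots> \<le> 1" using m assms(6) by simp
  finally have wh: "norm w + h \<le> 1" .
  define \<xi> where "\<xi> = (\<lambda>u. c * rescale \<psi> w h u)"
  have \<xi>: "\<xi> \<in> unit_tests r"
    unfolding \<xi>_def c_def by (rule scaled_rescale_in_unit_tests[OF \<psi> h wh])
  have "rescale \<xi> z m = (\<lambda>u. c * rescale (rescale \<psi> w h) z m u)"
    by (simp add: rescale_def \<xi>_def mult_ac)
  also have "rescale (rescale \<psi> w h) z m = rescale \<psi> y l"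
    using m by (simp add: rescale_rescale w_def h_def)
  finally have "rescale \<xi> z m = (\<lambda>u. c * rescale \<psi> y l u)" .
  moreover have "rescale \<psi> y l \<in> test_funs"
    using \<psi> assms(5) by (intro rescale_in_test_funs) (auto simp: unit_tests_def)
  ultimately have "T (rescale \<xi> z m) = c * T (rescale \<psi> y l)"
    and "S (rescale \<xi> z m) = c * S (rescale \<psi> y l)"
    using assms(1,2) by (simp_all add: distribution_def)
  with est[OF \<xi>] have "\<bar>c * (T (rescale \<psi> y l) - S (rescale \<psi> y l))\<bar> \<le> M"
    by (simp add: right_diff_distrib)
  then have "\<bar>T (rescale \<psi> y l) - S (rescale \<psi> y l)\<bar> \<le> M * inverse c"
    using c by (simp add: abs_mult pos_le_divide_eq divide_inverse[symmetric] mult.commute)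
  also have "inverse c = h powr (- real r - real CARD('n))"
  proof -
    have "c = h powr real (CARD('n) + r)" using h by (simp only: c_def powr_realpow)
    then show ?thesis by (simp add: powr_minus[symmetric] minus_diff_commute)
  qed
  finally show ?thesis by (simp add: h_def)
qed

theorem proposition6p2:
  fixes F :: "real ^ 'n::finite \<Rightarrow> (real ^ 'n \<Rightarrow> real) \<Rightarrow> real"
    and f :: "(real ^ 'n \<Rightarrow> real) \<Rightarrow> real"
    and \<gamma> C \<alpha> :: real and r :: nat and K :: "(real ^ 'n) set"
  assumes "germ F" and "distribution f" and "r \<ge> 1"
    and "\<forall>x\<in>K. \<forall>l\<in>{0<..1}. \<forall>\<psi>\<in>unit_tests r.
           \<bar>f (rescale \<psi> x l) - F x (rescale \<psi> x l)\<bar> \<le> C * l powr \<gamma>"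
    and "\<alpha> = min (- real r - real CARD('n)) \<gamma>"
  shows "\<forall>y\<in>K. \<forall>z\<in>K. norm (z - y) \<le> 1 / 2 \<longrightarrow>
           (\<forall>l\<in>{0<..1/2}. \<forall>\<psi>\<in>unit_tests r.
             \<bar>F z (rescale \<psi> y l) - F y (rescale \<psi> y l)\<bar>
               \<le> 2 * C * l powr \<alpha> * (norm (z - y) + l) powr (\<gamma> - \<alpha>))"
proof (intro ballI impI)
  fix y z :: "real ^ 'n" and l and \<psi> :: "real ^ 'n \<Rightarrow> real"
  assume yz: "y \<in> K" "z \<in> K" "norm (z - y) \<le> 1 / 2"
    and "l \<in> {0<..1/2::real}" and \<psi>: "\<psi> \<in> unit_tests r"
  then have l: "0 < l" "l \<le> 1/2" by auto
  define m where "m = norm (z - y) + l"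
  have m: "l \<le> m" "0 < m" "m \<le> 1"
    using l yz(3) norm_ge_zero[of "z - y"] unfolding m_def by linarith+
  let ?B = "C * l powr \<alpha> * m powr (\<gamma> - \<alpha>)"
  have near: "\<bar>f (rescale \<psi> y l) - F y (rescale \<psi> y l)\<bar> \<le> C * l powr \<gamma>"
    using assms(4) yz(1) l \<psi> by simp
  have "0 \<le> C * l powr \<gamma>" using near by (rule order_trans[OF abs_ge_zero])
  then have C: "C \<ge> 0" using l by (simp add: zero_le_mult_iff)
  have "l powr \<gamma> = l powr \<alpha> * l powr (\<gamma> - \<alpha>)"
    by (simp add: powr_add[symmetric])
  also have "\<dots> \<le> l powr \<alpha> * m powr (\<gamma> - \<alpha>)"
    using l m assms(5) by (intro mult_left_mono powr_mono2) auto
  finally have near': "C * l powr \<gamma> \<le> ?B"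
    using C by (simp add: mult_left_mono mult.assoc)
  have "\<bar>f (rescale \<psi> y l) - F z (rescale \<psi> y l)\<bar>
      \<le> C * m powr \<gamma> * (l / m) powr (- real r - real CARD('n))"
  proof (rule recentered_estimate[OF _ _ _ \<psi>])
    show "distribution (F z)" using assms(1) by (simp add: germ_def)
    show "norm (y - z) + l \<le> m" by (simp add: m_def norm_minus_commute)
  qed (use assms(2,4) yz(2) l m in auto)
  also have "\<dots> \<le> C * m powr \<gamma> * (l / m) powr \<alpha>"
    using C l m assms(5) by (intro mult_left_mono powr_mono') auto
  also have "\<dots> = ?B"
    using l m by (simp add: powr_divide powr_diff)
  finally have far: "\<bar>f (rescale \<psi> y l) - F z (rescale \<psi> y l)\<bar> \<le> ?B" .
  have "\<bar>F z (rescale \<psi> y l) - F y (rescale \<psi> y l)\<bar> \<le> 2 * ?B"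
    using near near' far by linarith
  then show "\<bar>F z (rescale \<psi> y l) - F y (rescale \<psi> y l)\<bar>
      \<le> 2 * C * l powr \<alpha> * (norm (z - y) + l) powr (\<gamma> - \<alpha>)"
    by (simp add: m_def mult.assoc)
qed

end
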